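(* Let $\Omega$ be an infinite set. The quotient monoid $\mathbb{G}_\Omega=\mathcal{G}_\Omega/\equiv$ is a group.
   Context: A subset $A\subseteq\Omega$ is cofinite if $\Omega\setminus A$ is finite. A function $f:\Omega\to\Omega$ is a near-bijection if there exist cofinite subsets $A,B\subseteq\Omega$ such that $f$ restricts to a bijection $A\to B$. $\mathcal{G}_\Omega$ denotes the set of all near-bijections $\Omega\to\Omega$; it is a monoid under composition, with the identity map as identity element. For self-maps $f,g$ of $\Omega$, $f\equiv g$ (almost equal) means that $\{\omega\in\Omega: f(\omega)\neq g(\omega)\}$ is finite; this is an equivalence relation, and composition in $\mathcal{G}_\Omega$ respects it. $\mathbb{G}_\Omega=\mathcal{G}_\Omega/\equiv$ is the resulting quotient monoid, whose elements are the classes $[f]$ with $f\in\mathcal{G}_\Omega$ and whose operation is $[g][f]=[g\circ f]$. *)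

theory Defs
  imports "HOL-Algebra.Group" "HOL-Library.FuncSet"
begin

definition cofinite_in :: "'a set \<Rightarrow> 'a set \<Rightarrow> bool"
  where "cofinite_in \<Omega> A \<longleftrightarrow> A \<subseteq> \<Omega> \<and> finite (\<Omega> - A)"

text \<open>A self-map of \<open>\<Omega>\<close> is an element of \<open>\<Omega> \<rightarrow>\<^sub>E \<Omega>\<close>: pinning the value outside \<open>\<Omega>\<close> makes
  equality of HOL functions coincide with equality of maps on \<open>\<Omega>\<close>.\<close>

definition near_bijections :: "'a set \<Rightarrow> ('a \<Rightarrow> 'a) set"
  where "near_bijections \<Omega> =
    {f \<in> \<Omega> \<rightarrow>\<^sub>E \<Omega>. \<exists>A B. cofinite_in \<Omega> A \<and> cofinite_in \<Omega> B \<and> bij_betw f A B}"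

definition near_bij_monoid :: "'a set \<Rightarrow> ('a \<Rightarrow> 'a) monoid"
  where "near_bij_monoid \<Omega> =
    \<lparr>carrier = near_bijections \<Omega>, mult = compose \<Omega>, one = (\<lambda>x\<in>\<Omega>. x)\<rparr>"

definition almost_equal :: "'a set \<Rightarrow> (('a \<Rightarrow> 'a) \<times> ('a \<Rightarrow> 'a)) set"
  where "almost_equal \<Omega> =
    {(f, g). f \<in> \<Omega> \<rightarrow>\<^sub>E \<Omega> \<and> g \<in> \<Omega> \<rightarrow>\<^sub>E \<Omega> \<and> finite {x \<in> \<Omega>. f x \<noteq> g x}}"

text \<open>For a congruence \<open>r\<close> on \<open>M\<close>, the classes united in \<open>mult\<close> all coincide, so the product of the
  classes of \<open>x\<close> and \<open>y\<close> is the class of \<open>x \<otimes>\<^bsub>M\<^esub> y\<close>.\<close>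

definition quotient_monoid :: "'b monoid \<Rightarrow> ('b \<times> 'b) set \<Rightarrow> 'b set monoid"
  where "quotient_monoid M r =
    \<lparr>carrier = carrier M // r,
     mult = (\<lambda>X Y. \<Union>x\<in>X. \<Union>y\<in>Y. r `` {x \<otimes>\<^bsub>M\<^esub> y}),
     one = r `` {\<one>\<^bsub>M\<^esub>}\<rparr>"

definition near_symmetric_group :: "'a set \<Rightarrow> ('a \<Rightarrow> 'a) set monoid"
  where "near_symmetric_group \<Omega> =
    quotient_monoid (near_bij_monoid \<Omega>) (Restr (almost_equal \<Omega>) (near_bijections \<Omega>))"

end

theory Submission
  imports Defs
begin

text \<open>
  Inverting a near-bijection \<open>f\<close> on a cofinite set that it maps bijectively onto a cofinite set,
  and extending the result to \<open>\<Omega>\<close> in any way, gives a near-bijection \<open>g\<close> with \<open>g \<circ> f\<close> almost equal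
  to the identity. So every class has a left inverse, and a monoid with left inverses is a group.

  That the classes form a monoid at all rests on one finiteness property: a near-bijection pulls
  finite sets back to finite sets, since outside a finite set it is injective
  (\<open>finite_preimage_near_bijection\<close>). Pulling back finite exceptional sets along the inner map of a
  composition shows both that near-bijections compose and that almost equality is a
  congruence. The passage to the quotient is a fact about arbitrary monoid congruences
  (\<open>group_quotient_monoidI\<close>).
\<close>

lemma mult_quotient_monoid_classes:
  assumes r: "equiv (carrier M) r"
    and cong: "\<And>x x' y y'. \<lbrakk>(x, x') \<in> r; (y, y') \<in> r\<rbrakk>
      \<Longrightarrow> (x \<otimes>\<^bsub>M\<^esub> y, x' \<otimes>\<^bsub>M\<^esub> y') \<in> r"
    and "x \<in> carrier M" "y \<in> carrier M"
  shows "r `` {x} \<otimes>\<^bsub>quotient_monoid M r\<^esub> r `` {y} = r `` {x \<otimes>\<^bsub>M\<^esub> y}"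
proof -
  have "congruent2 r r (\<lambda>x y. r `` {x \<otimes>\<^bsub>M\<^esub> y})"
    using cong by (auto intro!: congruent2I' equiv_class_eq [OF r])
  from UN_equiv_class2 [OF r r this assms(3,4)] show ?thesis
    by (simp add: quotient_monoid_def)
qed

text \<open>Inverses are demanded only up to \<open>r\<close>, so \<open>M\<close> itself may be far from a group.\<close>

lemma group_quotient_monoidI:
  assumes M: "monoid M"
    and r: "equiv (carrier M) r"
    and cong: "\<And>x x' y y'. \<lbrakk>(x, x') \<in> r; (y, y') \<in> r\<rbrakk>
      \<Longrightarrow> (x \<otimes>\<^bsub>M\<^esub> y, x' \<otimes>\<^bsub>M\<^esub> y') \<in> r"
    and l_inv: "\<And>x. x \<in> carrier M \<Longrightarrow> \<exists>y\<in>carrier M. (y \<otimes>\<^bsub>M\<^esub> x, \<one>\<^bsub>M\<^esub>) \<in> r"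
  shows "group (quotient_monoid M r)"
proof -
  interpret monoid M by (fact M)
  let ?Q = "quotient_monoid M r"
  note mult = mult_quotient_monoid_classes [of M r, OF r cong]
  have carrier: "carrier ?Q = carrier M // r" and one: "\<one>\<^bsub>?Q\<^esub> = r `` {\<one>\<^bsub>M\<^esub>}"
    by (simp_all add: quotient_monoid_def)
  have cls: "r `` {x} \<in> carrier ?Q" if "x \<in> carrier M" for x
    using that by (simp add: carrier quotientI)
  have rep: "\<exists>x\<in>carrier M. X = r `` {x}" if "X \<in> carrier ?Q" for X
    using that by (auto simp: carrier elim: quotientE)
  show ?thesis
  proof (rule groupI)
    fix X Y assume "X \<in> carrier ?Q" "Y \<in> carrier ?Q"
    then obtain x y where "x \<in> carrier M" "y \<in> carrier M" "X = r `` {x}" "Y = r `` {y}"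
      using rep by meson
    then show "X \<otimes>\<^bsub>?Q\<^esub> Y \<in> carrier ?Q" by (simp add: mult cls)
  next
    show "\<one>\<^bsub>?Q\<^esub> \<in> carrier ?Q" by (simp add: one cls)
  next
    fix X Y Z assume "X \<in> carrier ?Q" "Y \<in> carrier ?Q" "Z \<in> carrier ?Q"
    then obtain x y z where "x \<in> carrier M" "y \<in> carrier M" "z \<in> carrier M"
      "X = r `` {x}" "Y = r `` {y}" "Z = r `` {z}"
      using rep by meson
    then show "X \<otimes>\<^bsub>?Q\<^esub> Y \<otimes>\<^bsub>?Q\<^esub> Z = X \<otimes>\<^bsub>?Q\<^esub> (Y \<otimes>\<^bsub>?Q\<^esub> Z)"
      by (simp add: mult m_assoc)
  next
    fix X assume "X \<in> carrier ?Q"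
    then obtain x where x: "x \<in> carrier M" "X = r `` {x}"
      using rep by meson
    then show "\<one>\<^bsub>?Q\<^esub> \<otimes>\<^bsub>?Q\<^esub> X = X" by (simp add: one mult)
    from l_inv [OF x(1)] obtain y where y: "y \<in> carrier M" "(y \<otimes>\<^bsub>M\<^esub> x, \<one>\<^bsub>M\<^esub>) \<in> r" by blast
    have "r `` {y} \<otimes>\<^bsub>?Q\<^esub> X = \<one>\<^bsub>?Q\<^esub>"
      using x y by (simp add: one mult equiv_class_eq [OF r])
    then show "\<exists>Y\<in>carrier ?Q. Y \<otimes>\<^bsub>?Q\<^esub> X = \<one>\<^bsub>?Q\<^esub>"
      using cls [OF y(1)] by blast
  qed
qed

lemma near_bijectionsI:
  assumes "f \<in> \<Omega> \<rightarrow>\<^sub>E \<Omega>" "cofinite_in \<Omega> A" "cofinite_in \<Omega> B" "bij_betw f A B"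
  shows "f \<in> near_bijections \<Omega>"
  using assms by (auto simp: near_bijections_def)

lemma near_bijectionsE:
  assumes "f \<in> near_bijections \<Omega>"
  obtains A B where "f \<in> \<Omega> \<rightarrow>\<^sub>E \<Omega>" "A \<subseteq> \<Omega>" "finite (\<Omega> - A)" "B \<subseteq> \<Omega>" "finite (\<Omega> - B)"
    "bij_betw f A B"
  using assms by (auto simp: near_bijections_def cofinite_in_def)

lemma id_near_bijection: "(\<lambda>x\<in>\<Omega>. x) \<in> near_bijections \<Omega>"
  by (rule near_bijectionsI [where A = \<Omega> and B = \<Omega>])
    (auto simp: cofinite_in_def bij_betw_def inj_on_def)

lemma finite_preimage_near_bijection:
  assumes "f \<in> near_bijections \<Omega>" "finite F"
  shows "finite {x \<in> \<Omega>. f x \<in> F}"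
proof -
  obtain A B where "finite (\<Omega> - A)" "bij_betw f A B"
    using assms(1) by (elim near_bijectionsE)
  then have "finite ((\<Omega> - A) \<union> (f -` F \<inter> A))"
    using assms(2) by (auto intro: finite_vimage_IntI simp: bij_betw_def)
  then show ?thesis
    by (rule rev_finite_subset) auto
qed

text \<open>If \<open>f\<close> maps \<open>A\<close> onto \<open>B\<close> and \<open>g\<close> maps \<open>A'\<close> onto \<open>B'\<close>, the composition is a bijection from the
  \<open>f\<close>-preimage of \<open>B \<inter> A'\<close> in \<open>A\<close> to the image \<open>g ` (B \<inter> A')\<close>. The first set is cofinite because
  \<open>f\<close> has finite preimages of finite sets, the second because it misses from \<open>B'\<close> only
  \<open>g ` (A' - B)\<close>.\<close>

lemma compose_near_bijections:
  assumes f: "f \<in> near_bijections \<Omega>" and g: "g \<in> near_bijections \<Omega>"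
  shows "compose \<Omega> g f \<in> near_bijections \<Omega>"
proof -
  obtain A B where fA: "f \<in> \<Omega> \<rightarrow>\<^sub>E \<Omega>" "A \<subseteq> \<Omega>" "finite (\<Omega> - A)" "B \<subseteq> \<Omega>" "finite (\<Omega> - B)"
    "bij_betw f A B" using f by (rule near_bijectionsE)
  obtain A' B' where gA: "g \<in> \<Omega> \<rightarrow>\<^sub>E \<Omega>" "A' \<subseteq> \<Omega>" "finite (\<Omega> - A')" "B' \<subseteq> \<Omega>" "finite (\<Omega> - B')"
    "bij_betw g A' B'" using g by (rule near_bijectionsE)
  let ?C = "{x \<in> A. f x \<in> A'}" and ?D = "g ` (B \<inter> A')"
  show ?thesis
  proof (rule near_bijectionsI)
    show "compose \<Omega> g f \<in> \<Omega> \<rightarrow>\<^sub>E \<Omega>"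
      using fA(1) gA(1) by (auto simp: compose_def)
    have "finite ((\<Omega> - A) \<union> {x \<in> \<Omega>. f x \<in> \<Omega> - A'})"
      using fA(3) finite_preimage_near_bijection [OF f gA(3)] by simp
    moreover have "\<Omega> - ?C \<subseteq> (\<Omega> - A) \<union> {x \<in> \<Omega>. f x \<in> \<Omega> - A'}"
      using fA(1) by auto
    ultimately show "cofinite_in \<Omega> ?C"
      using fA(2) by (auto simp: cofinite_in_def intro: finite_subset)
    have "finite ((\<Omega> - B') \<union> g ` (\<Omega> - B))"
      using gA(5) fA(5) by simp
    moreover have "\<Omega> - ?D \<subseteq> (\<Omega> - B') \<union> g ` (\<Omega> - B)"
      using gA(2,6) by (auto simp: bij_betw_def)
    ultimately show "cofinite_in \<Omega> ?D"
      using gA(1,2) by (auto simp: cofinite_in_def intro: finite_subset)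
    have "bij_betw f ?C (B \<inter> A')"
      using fA(6) by (auto simp: bij_betw_def inj_on_def)
    moreover have "bij_betw g (B \<inter> A') ?D"
      using gA(6) by (auto simp: bij_betw_def inj_on_def)
    ultimately have "bij_betw (g \<circ> f) ?C ?D"
      by (rule bij_betw_trans)
    then show "bij_betw (compose \<Omega> g f) ?C ?D"
      using fA(2) by (subst bij_betw_cong [where g = "g \<circ> f"]) (auto simp: compose_def)
  qed
qed

lemma monoid_near_bij_monoid: "monoid (near_bij_monoid \<Omega>)"
proof -
  have maps: "f \<in> \<Omega> \<rightarrow> \<Omega>" "f \<in> extensional \<Omega>" if "f \<in> near_bijections \<Omega>" for f
    using that by (auto simp: near_bijections_def PiE_def)
  show ?thesis
    by (rule monoidI)
      (simp_all add: near_bij_monoid_def compose_near_bijections id_near_bijection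
        maps Id_compose [where B = \<Omega>] compose_Id [where B = \<Omega>]
        compose_assoc [where B = \<Omega>])
qed

lemma equiv_almost_equal: "equiv (\<Omega> \<rightarrow>\<^sub>E \<Omega>) (almost_equal \<Omega>)"
proof (rule equivI)
  show "trans (almost_equal \<Omega>)"
  proof (rule transI)
    fix f g h assume fg: "(f, g) \<in> almost_equal \<Omega>" and gh: "(g, h) \<in> almost_equal \<Omega>"
    have "finite ({x \<in> \<Omega>. f x \<noteq> g x} \<union> {x \<in> \<Omega>. g x \<noteq> h x})"
      using fg gh by (simp add: almost_equal_def)
    then have "finite {x \<in> \<Omega>. f x \<noteq> h x}"
      by (rule rev_finite_subset) auto
    with fg gh show "(f, h) \<in> almost_equal \<Omega>"
      by (simp add: almost_equal_def)
  qed
qed (auto simp: almost_equal_def refl_on_def sym_def eq_commute)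

text \<open>The two compositions can differ at \<open>x\<close> only if \<open>f\<close> and \<open>f'\<close> differ there or \<open>g\<close> and \<open>g'\<close>
  differ at \<open>f x\<close>. The latter happens for finitely many \<open>x\<close> because \<open>f\<close> is a near-bijection; a
  constant \<open>f\<close> could turn one difference of \<open>g\<close> and \<open>g'\<close> into infinitely many.\<close>

lemma almost_equal_compose:
  assumes f: "f \<in> near_bijections \<Omega>"
    and ff': "(f, f') \<in> almost_equal \<Omega>" and gg': "(g, g') \<in> almost_equal \<Omega>"
  shows "(compose \<Omega> g f, compose \<Omega> g' f') \<in> almost_equal \<Omega>"
proof -
  have maps: "f \<in> \<Omega> \<rightarrow>\<^sub>E \<Omega>" "f' \<in> \<Omega> \<rightarrow>\<^sub>E \<Omega>" "g \<in> \<Omega> \<rightarrow>\<^sub>E \<Omega>" "g' \<in> \<Omega> \<rightarrow>\<^sub>E \<Omega>"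
    using ff' gg' by (simp_all add: almost_equal_def)
  have "finite ({x \<in> \<Omega>. f x \<noteq> f' x} \<union> {x \<in> \<Omega>. f x \<in> {y \<in> \<Omega>. g y \<noteq> g' y}})"
    using ff' gg' finite_preimage_near_bijection [OF f, of "{y \<in> \<Omega>. g y \<noteq> g' y}"]
    by (simp add: almost_equal_def)
  then have "finite {x \<in> \<Omega>. compose \<Omega> g f x \<noteq> compose \<Omega> g' f' x}"
    by (rule rev_finite_subset) (use maps in \<open>auto simp: compose_def\<close>)
  then show ?thesis
    using maps by (auto simp: almost_equal_def compose_def)
qed

lemma near_bijection_left_inverse:
  assumes "f \<in> near_bijections \<Omega>"
  shows "\<exists>g\<in>near_bijections \<Omega>. (compose \<Omega> g f, \<lambda>x\<in>\<Omega>. x) \<in> almost_equal \<Omega>"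
proof -
  obtain A B where f: "f \<in> \<Omega> \<rightarrow>\<^sub>E \<Omega>" and A: "A \<subseteq> \<Omega>" "finite (\<Omega> - A)"
    and B: "B \<subseteq> \<Omega>" "finite (\<Omega> - B)" and bij: "bij_betw f A B"
    using assms by (rule near_bijectionsE)
  \<comment> \<open>Off \<open>B\<close> any values in \<open>\<Omega>\<close> would do.\<close>
  define g where "g = (\<lambda>y\<in>\<Omega>. if y \<in> B then inv_into A f y else y)"
  have inv: "bij_betw (inv_into A f) B A"
    using bij by (rule bij_betw_inv_into)
  have g: "g \<in> \<Omega> \<rightarrow>\<^sub>E \<Omega>"
    using bij_betwE [OF inv] A(1) by (auto simp: g_def subset_iff)
  have "bij_betw g B A"
    using inv B(1) by (subst bij_betw_cong [where g = "inv_into A f"]) (auto simp: g_def)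
  with g A B have "g \<in> near_bijections \<Omega>"
    by (auto intro: near_bijectionsI simp: cofinite_in_def)
  moreover have "g (f x) = x" if "x \<in> A" for x
    using that bij B(1) by (auto simp: g_def bij_betw_def)
  then have "{x \<in> \<Omega>. compose \<Omega> g f x \<noteq> (\<lambda>x\<in>\<Omega>. x) x} \<subseteq> \<Omega> - A"
    by (auto simp: compose_def)
  then have "finite {x \<in> \<Omega>. compose \<Omega> g f x \<noteq> (\<lambda>x\<in>\<Omega>. x) x}"
    using A(2) by (rule finite_subset)
  then have "(compose \<Omega> g f, \<lambda>x\<in>\<Omega>. x) \<in> almost_equal \<Omega>"
    unfolding almost_equal_def using f g by (auto simp: compose_def)
  ultimately show ?thesis by blast
qed

theorem theorem25:
  fixes \<Omega> :: "'a set"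
  assumes "infinite \<Omega>"
  shows "group (near_symmetric_group \<Omega>)"
  unfolding near_symmetric_group_def
proof (rule group_quotient_monoidI)
  show "monoid (near_bij_monoid \<Omega>)"
    by (rule monoid_near_bij_monoid)
  show "equiv (carrier (near_bij_monoid \<Omega>)) (Restr (almost_equal \<Omega>) (near_bijections \<Omega>))"
    using equiv_almost_equal [of \<Omega>]
    by (auto simp: near_bij_monoid_def near_bijections_def equiv_def refl_on_def
        intro: sym_Int trans_Restr symI dest: symD)
qed (auto simp: near_bij_monoid_def almost_equal_compose compose_near_bijections id_near_bijection
      dest: near_bijection_left_inverse)

end
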